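(* Let $n\geq1$ and let $\mu_1,\mu_2^2\geq0$ be constants such that $\delta:=(\mu_1-1)^2-4\mu_2^2\geq0$. Let $u\in\mathcal{C}^2([0,T)\times\mathbb{R}^n)$ be a solution of $$u_{tt}-\Delta u+\frac{\mu_1}{1+t}u_t+\frac{\mu_2^2}{(1+t)^2}u=|u|^p,\qquad u(0,\cdot)=u_0,\ u_t(0,\cdot)=u_1,$$ where $T>0$ is the life-span of $u$, with compactly supported initial data satisfying $$\int_{\mathbb{R}^n}u_0(x)\,dx>0,\qquad \int_{\mathbb{R}^n}\Big(u_1(x)+\Big(\tfrac{\mu_1-1}{2}-\tfrac{\sqrt\delta}{2}\Big)u_0(x)\Big)dx>0.$$ If $1<p\leq p_{\mathrm{Fuj}}\big(n+\tfrac{\mu_1-1}{2}-\tfrac{\sqrt\delta}{2}\big)$, then $T<\infty$, i.e. $u$ blows up in finite time.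
   Context: $p_{\mathrm{Fuj}}(k)=1+\frac{2}{k}$. *)

theory Defs
  imports "HOL-Analysis.Analysis"
begin

definition pFuj :: "real \<Rightarrow> ereal" where
  "pFuj k = (if k = 0 then \<infinity> else ereal (1 + 2 / k))"

text \<open>Points of [0,T) x R^n are pairs (t,x).  u is C^2 on S = [0,\<infinity>) x R^n:
  first and second Frechet derivatives (one-sided at t = 0, i.e. taken within S)
  exist and are continuous on S.\<close>

definition e_t :: "real \<times> (real ^ 'n)" where
  "e_t = (1, 0)"

definition e_x :: "'n \<Rightarrow> real \<times> (real ^ 'n)" where
  "e_x i = (0, axis i 1)"

definition global_C2_solution ::
  "real \<Rightarrow> real \<Rightarrow> real \<Rightarrow> ((real ^ 'n) \<Rightarrow> real) \<Rightarrow> ((real ^ 'n) \<Rightarrow> real)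
   \<Rightarrow> (real \<times> (real ^ 'n) \<Rightarrow> real) \<Rightarrow> bool" where
  "global_C2_solution mu1 mu2sq p u0 u1 u \<longleftrightarrow>
     (\<exists>(Du :: real \<times> (real ^ 'n) \<Rightarrow> (real \<times> (real ^ 'n)) \<Rightarrow>\<^sub>L real)
        (D2u :: real \<times> (real ^ 'n) \<Rightarrow> (real \<times> (real ^ 'n)) \<Rightarrow>\<^sub>L ((real \<times> (real ^ 'n)) \<Rightarrow>\<^sub>L real)).
       let S = {0..} \<times> (UNIV :: (real ^ 'n) set) in
       (\<forall>z\<in>S. (u has_derivative blinfun_apply (Du z)) (at z within S)) \<and>
       continuous_on S Du \<and>
       (\<forall>z\<in>S. (Du has_derivative blinfun_apply (D2u z)) (at z within S)) \<and>
       continuous_on S D2u \<and>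
       (\<forall>t x. t \<ge> 0 \<longrightarrow>
          D2u (t, x) e_t e_t - (\<Sum>i\<in>UNIV. D2u (t, x) (e_x i) (e_x i))
          + mu1 / (1 + t) * Du (t, x) e_t + mu2sq / (1 + t)^2 * u (t, x)
          = \<bar>u (t, x)\<bar> powr p) \<and>
       (\<forall>x. u (0, x) = u0 x) \<and>
       (\<forall>x. Du (0, x) e_t = u1 x))"

end

theory Submission
  imports Defs
begin

text \<open>With \<open>\<beta> = (mu1 + 1) / 2 - sqrt \<delta> / 2\<close>, the function \<open>(1 + t) powr \<beta>\<close> solves the adjoint linear
  equation. Testing the equation against \<open>(1 + t) powr \<beta> * (max 0 (1 - (t\<^sup>2 + \<bar>x\<bar>\<^sup>2) / R\<^sup>2)) ^ m\<close>, all
  derivatives fall on the cutoff and cost a factor \<open>1 / R\<^sup>2\<close>. By Young's inequality the linear side is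
  at most \<open>l\<close> times the nonlinear side plus a multiple of
  \<open>l powr (- 1 / (p - 1)) * R powr (n + 1 + \<beta> - 2 * p / (p - 1))\<close>, and the exponent of \<open>R\<close> is nonpositive
  exactly when \<open>p\<close> is at most the Fujita exponent. Taking \<open>l = 1/2\<close> shows that \<open>(1 + t) powr \<beta> * \<bar>u\<bar> powr p\<close>
  is integrable; letting \<open>R\<close> and then \<open>l\<close> tend to infinity contradicts the positivity of the initial
  term.\<close>

section \<open>Integrability and integration by parts on the whole space and on the half-space of
  nonnegative times\<close>

lemma integrable_continuous_bounded_support:
  fixes g :: "'a::euclidean_space \<Rightarrow> real"
  assumes "closed S" "continuous_on S g" "\<And>z. z \<in> S \<Longrightarrow> norm z > R \<Longrightarrow> g z = 0"
  shows "integrable lborel (\<lambda>z. indicator S z * g z)"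
proof -
  have "compact (S \<inter> cball 0 R)"
    using assms(1) by (simp add: closed_Int_compact)
  then have "integrable lborel (\<lambda>z. indicator (S \<inter> cball 0 R) z *\<^sub>R g z)"
    using assms(2) by (intro borel_integrable_compact) (auto intro: continuous_on_subset)
  also have "(\<lambda>z. indicator (S \<inter> cball 0 R) z *\<^sub>R g z) = (\<lambda>z. indicator S z * g z)"
    using assms(3) by (force simp: indicator_def)
  finally show ?thesis .
qed

lemma integral_lborel_translate:
  fixes f :: "'a::euclidean_space \<Rightarrow> real"
  assumes [measurable]: "f \<in> borel_measurable borel"
  shows "(\<integral>x. f (x + a) \<partial>lborel) = integral\<^sup>L lborel f"
proof -
  have "integral\<^sup>L lborel f = integral\<^sup>L (distr lborel borel ((+) a)) f"
    by (simp add: lborel_distr_plus)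
  also have "\<dots> = (\<integral>x. f (a + x) \<partial>lborel)"
    by (intro integral_distr) auto
  finally show ?thesis by (simp add: add.commute)
qed

lemma integrable_lborel_translate:
  fixes f :: "'a::euclidean_space \<Rightarrow> real"
  assumes "integrable lborel f"
  shows "integrable lborel (\<lambda>x. f (x + a))"
proof -
  have "integrable (distr lborel borel ((+) a)) f"
    using assms by (simp add: lborel_distr_plus)
  then have "integrable lborel (\<lambda>x. f (a + x))"
    by (rule integrable_distr[rotated]) auto
  then show ?thesis by (simp add: add.commute)
qed

text \<open>Integrate \<open>f' (z + s *\<^sub>R e)\<close> over all \<open>z\<close> and over
  \<open>s\<close> in the unit interval. Translation invariance turns this double integral into the
  integral of \<open>f'\<close>; in the other order, the inner integral is
  \<open>f (z + e) - f z\<close>, which integrates to zero. Regularity is asked only along lines in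
  direction \<open>e\<close>, so \<open>f\<close> may jump across the hyperplane
  \<open>t = 0\<close> when \<open>e\<close> is a space direction.\<close>

lemma integral_directional_derivative_eq_0:
  fixes f f' :: "'a::euclidean_space \<Rightarrow> real"
  assumes f: "integrable lborel f" and f': "integrable lborel f'"
    and deriv: "\<And>z s. ((\<lambda>s. f (z + s *\<^sub>R e)) has_real_derivative f' (z + s *\<^sub>R e)) (at s)"
    and cont: "\<And>z. continuous_on UNIV (\<lambda>s. f' (z + s *\<^sub>R e))"
  shows "integral\<^sup>L lborel f' = 0"
proof -
  let ?g = "\<lambda>(s::real, z). indicator {0..1} s * f' (z + s *\<^sub>R e)"
  have [measurable]: "f' \<in> borel_measurable borel" "f \<in> borel_measurable borel"
    using f f' by auto
  have norm: "(\<integral>z. norm (?g (s, z)) \<partial>lborel)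
      = indicator {0..1} s *\<^sub>R (\<integral>z. norm (f' z) \<partial>lborel)" for s
    using integral_lborel_translate[of "\<lambda>z. norm (f' z)" "s *\<^sub>R e"]
    by (auto simp: indicator_def)
  have int: "integrable (lborel \<Otimes>\<^sub>M lborel) ?g"
  proof (rule lborel_pair.Fubini_integrable)
    show "?g \<in> borel_measurable (lborel \<Otimes>\<^sub>M lborel)"
      by measurable
    show "integrable lborel (\<lambda>s. \<integral>z. norm (?g (s, z)) \<partial>lborel)"
      unfolding norm by (intro borel_integrable_compact) auto
    show "AE s in lborel. integrable lborel (\<lambda>z. ?g (s, z))"
      using integrable_lborel_translate[OF f'] by auto
  qed
  have "(\<integral>(s::real). indicator {0..1} s *\<^sub>R integral\<^sup>L lborel f' \<partial>lborel)
      = (\<integral>s. \<integral>z. ?g (s, z) \<partial>lborel \<partial>lborel)"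
    by (rule Bochner_Integration.integral_cong) (simp_all add: integral_lborel_translate)
  also have "\<dots> = (\<integral>z. \<integral>s. ?g (s, z) \<partial>lborel \<partial>lborel)"
    using lborel_pair.Fubini_integral[of "\<lambda>s z. ?g (s, z)"] int by simp
  also have "\<dots> = (\<integral>z. f (z + e) - f z \<partial>lborel)"
  proof (rule Bochner_Integration.integral_cong)
    fix z
    have "has_bochner_integral lborel (\<lambda>s. indicator {0..1} s *\<^sub>R f' (z + s *\<^sub>R e))
       (f (z + 1 *\<^sub>R e) - f (z + 0 *\<^sub>R e))"
    proof (rule has_bochner_integral_FTC_Icc)
      show "((\<lambda>s. f (z + s *\<^sub>R e)) has_vector_derivative f' (z + s *\<^sub>R e)) (at s within {0..1})" for s
        using has_field_derivative_at_within[OF deriv]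
        by (simp add: has_real_derivative_iff_has_vector_derivative)
      show "continuous_on {0..1} (\<lambda>s. f' (z + s *\<^sub>R e))"
        using cont by (rule continuous_on_subset) simp
    qed simp
    then show "(\<integral>s. ?g (s, z) \<partial>lborel) = f (z + e) - f z"
      by (simp add: has_bochner_integral_iff)
  qed simp
  also have "\<dots> = 0"
    using integral_lborel_translate[of f e] f integrable_lborel_translate[OF f, of e] by simp
  finally have "integral\<^sup>L lborel f' * measure lborel {0..1::real} = 0"
    by (simp add: mult.commute)
  then show ?thesis by simp
qed

text \<open>By Fubini the time integral is taken first, and the fundamental theorem on
  \<open>{0..R}\<close> leaves only the term at \<open>t = 0\<close>: the point
  \<open>(R, x)\<close> has norm at least \<open>R\<close>, so \<open>g\<close> vanishes
  there.\<close>

lemma integral_halfspace_time_derivative: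
  fixes g g' :: "real \<times> 'a::euclidean_space \<Rightarrow> real"
  defines "S \<equiv> {0..} \<times> (UNIV :: 'a set)"
  assumes cont: "continuous_on S g'"
    and supp: "\<And>z. z \<in> S \<Longrightarrow> norm z \<ge> R \<Longrightarrow> g z = 0" "\<And>z. z \<in> S \<Longrightarrow> norm z > R \<Longrightarrow> g' z = 0"
    and deriv: "\<And>t x. t \<ge> 0 \<Longrightarrow> ((\<lambda>t. g (t, x)) has_real_derivative g' (t, x)) (at t within {0..})"
    and R: "R > 0"
  shows "(\<integral>z. indicator S z * g' z \<partial>lborel) = - (\<integral>x. g (0, x) \<partial>lborel)"
proof -
  have "closed S" unfolding S_def by (intro closed_Times) auto
  then have int: "integrable (lborel \<Otimes>\<^sub>M lborel) (\<lambda>z. indicator S z * g' z)"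
    using integrable_continuous_bounded_support[of S g' R] cont supp by (simp add: lborel_prod)
  have "(\<integral>z. indicator S z * g' z \<partial>lborel)
      = (\<integral>x. \<integral>t. indicator S (t, x) * g' (t, x) \<partial>lborel \<partial>lborel)"
    using lborel_pair.integral_snd[of "\<lambda>t x. indicator S (t, x) * g' (t, x)"] int
    by (simp add: lborel_prod case_prod_unfold)
  also have "\<dots> = (\<integral>x. - g (0, x) \<partial>lborel)"
  proof (rule Bochner_Integration.integral_cong)
    fix x
    have "has_bochner_integral lborel (\<lambda>t. indicator {0..R} t *\<^sub>R g' (t, x)) (g (R, x) - g (0, x))"
    proof (rule has_bochner_integral_FTC_Icc)
      show "continuous_on {0..R} (\<lambda>t. g' (t, x))"
        by (rule continuous_on_compose2[OF cont]) (auto simp: S_def intro!: continuous_intros)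
      fix t assume "0 \<le> t" "t \<le> R"
      then show "((\<lambda>t. g (t, x)) has_vector_derivative g' (t, x)) (at t within {0..R})"
        using DERIV_subset[OF deriv[of t x], of "{0..R}"]
        by (auto simp flip: has_real_derivative_iff_has_vector_derivative)
    qed (use R in auto)
    moreover have "g (R, x) = 0"
      using R norm_fst_le[of R x] by (intro supp(1)) (auto simp: S_def)
    \<comment> \<open>Beyond time \<open>R\<close> the norm of \<open>(t, x)\<close> exceeds
      \<open>R\<close>, so \<open>g'\<close> vanishes and the half-line may be cut to
      \<open>{0..R}\<close>.\<close>
    moreover have "(\<lambda>t. indicator {0..R} t *\<^sub>R g' (t, x)) = (\<lambda>t. indicator S (t, x) * g' (t, x))"
    proof
      show "indicator {0..R} t *\<^sub>R g' (t, x) = indicator S (t, x) * g' (t, x)" for t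
        using norm_fst_le[of t x] supp(2)[of "(t, x)"] by (auto simp: S_def indicator_def)
    qed
    ultimately show "(\<integral>t. indicator S (t, x) * g' (t, x) \<partial>lborel) = - g (0, x)"
      by (simp add: has_bochner_integral_iff)
  qed simp
  finally show ?thesis by simp
qed

section \<open>The cutoff and its directional derivatives\<close>

definition cutoff :: "real \<Rightarrow> 'a::real_inner \<Rightarrow> real" where
  "cutoff R z = max 0 (1 - (z \<bullet> z) / R\<^sup>2)"

text \<open>\<open>cutoff_D\<close> and \<open>cutoff_D2\<close> are the first and second
  derivatives of \<open>cutoff R z ^ m\<close> in direction \<open>e\<close>, in closed form. They
  are proved to be such for \<open>m\<close> at least 2 and at least 3 respectively.\<close>

definition cutoff_D :: "real \<Rightarrow> nat \<Rightarrow> 'a::real_inner \<Rightarrow> 'a \<Rightarrow> real" where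
  "cutoff_D R m e z = - 2 * real m * (z \<bullet> e) / R\<^sup>2 * cutoff R z ^ (m - 1)"

definition cutoff_D2 :: "real \<Rightarrow> nat \<Rightarrow> 'a::real_inner \<Rightarrow> 'a \<Rightarrow> real" where
  "cutoff_D2 R m e z = 4 * real m * real (m - 1) * (z \<bullet> e)\<^sup>2 / (R\<^sup>2)\<^sup>2 * cutoff R z ^ (m - 2)
     - 2 * real m * (e \<bullet> e) / R\<^sup>2 * cutoff R z ^ (m - 1)"

text \<open>An exponent of at least 2 smooths the corner of the positive part. Away from zero the
  function agrees locally with a power or with zero.\<close>

lemma max0_power_deriv:
  fixes g :: "real \<Rightarrow> real"
  assumes "(g has_real_derivative g') (at s within A)"
  shows "((\<lambda>s. (max 0 (g s)) ^ Suc (Suc k)) has_real_derivative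
           real (Suc (Suc k)) * (max 0 (g s)) ^ Suc k * g') (at s within A)"
proof -
  have "((\<lambda>y. (max 0 y) ^ Suc (Suc k)) has_real_derivative
           real (Suc (Suc k)) * (max 0 y) ^ Suc k) (at y)" for y :: real
  proof -
    consider "y > 0" | "y < 0" | "y = 0" by linarith
    then show ?thesis
    proof cases
      case 1
      have "((\<lambda>y. y ^ Suc (Suc k)) has_real_derivative
           real (Suc (Suc k)) * (max 0 y) ^ Suc k) (at y)"
        using DERIV_pow[of "Suc (Suc k)" y] 1 by simp
      then show ?thesis
        by (rule DERIV_cong_ev[THEN iffD1, rotated -1])
           (use 1 in \<open>auto intro!: eventually_mono[OF eventually_gt_at_top[of 0]] eventually_mono[OF order_tendstoD(1)[OF tendsto_ident_at 1]] simp: eventually_nhds intro: exI[of _ "{0<..}"]\<close>)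
    next
      case 2
      have "((\<lambda>y. 0) has_real_derivative
           real (Suc (Suc k)) * (max 0 y) ^ Suc k) (at y)"
        using 2 by (auto intro!: derivative_eq_intros)
      then show ?thesis
        by (rule DERIV_cong_ev[THEN iffD1, rotated -1])
           (use 2 in \<open>auto simp: eventually_nhds intro!: exI[of _ "{..<0}"]\<close>)
    next
      case 3
      \<comment> \<open>At zero Caratheodory's criterion applies: the difference quotient is
        \<open>(max 0 y) ^ Suc k\<close>, continuous with value 0.\<close>
      have "isCont (\<lambda>y. (max 0 y) ^ Suc k) (0::real)"
        by (intro continuous_intros)
      then show ?thesis
        unfolding CARAT_DERIV
        by (intro exI[of _ "\<lambda>y. (max 0 y) ^ Suc k"]) (auto simp: 3 max_def)
    qed
  qed
  from DERIV_chain2[OF this assms] show ?thesis .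
qed

lemma cutoff_line_deriv:
  "((\<lambda>s. cutoff R (z + s *\<^sub>R e) ^ Suc (Suc k)) has_real_derivative
     cutoff_D R (Suc (Suc k)) e (z + s *\<^sub>R e)) (at s within A)"
proof -
  have "((\<lambda>s. 1 - (z + s *\<^sub>R e) \<bullet> (z + s *\<^sub>R e) / R\<^sup>2) has_real_derivative
      - 2 * ((z + s *\<^sub>R e) \<bullet> e) / R\<^sup>2) (at s within A)"
  proof -
    have eq: "(z + s *\<^sub>R e) \<bullet> (z + s *\<^sub>R e) = z \<bullet> z + 2 * s * (z \<bullet> e) + s\<^sup>2 * (e \<bullet> e)" for s
      by (simp add: inner_simps inner_commute[of e z] power2_eq_square algebra_simps)
    have "((\<lambda>s. 1 - (z \<bullet> z + 2 * s * (z \<bullet> e) + s\<^sup>2 * (e \<bullet> e)) * inverse (R\<^sup>2)) has_real_derivative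
        - ((2 * (z \<bullet> e) + 2 * s * (e \<bullet> e)) * inverse (R\<^sup>2))) (at s within A)"
      by (auto intro!: derivative_eq_intros)
    then show ?thesis
      unfolding eq unfolding divide_inverse inner_add_left by (simp add: algebra_simps)
  qed
  from max0_power_deriv[OF this, of k] show ?thesis
    by (simp only: cutoff_def cutoff_D_def diff_Suc_1 times_divide_eq_right times_divide_eq_left mult_ac)
qed

text \<open>\<open>cutoff_D\<close> is a function affine in \<open>s\<close> times the cutoff to the
  power \<open>m - 1\<close>; with three successors this power is still at least 2, so
  \<open>cutoff_line_deriv\<close> differentiates it.\<close>

lemma cutoff_D_line_deriv:
  "((\<lambda>s. cutoff_D R (Suc (Suc (Suc k))) e (z + s *\<^sub>R e)) has_real_derivative
     cutoff_D2 R (Suc (Suc (Suc k))) e (z + s *\<^sub>R e)) (at s within A)"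
proof -
  let ?m = "Suc (Suc (Suc k))"
  have 1: "((\<lambda>s. - 2 * real ?m * ((z + s *\<^sub>R e) \<bullet> e) / R\<^sup>2) has_real_derivative
      - 2 * real ?m * (e \<bullet> e) / R\<^sup>2) (at s within A)"
    unfolding divide_inverse inner_add_left inner_scaleR_left
    by (rule derivative_eq_intros refl)+ simp
  show ?thesis
    unfolding cutoff_D_def
    by (rule DERIV_cong, simp only: diff_Suc_Suc diff_Suc_1, rule DERIV_mult[OF 1 cutoff_line_deriv])
      (simp add: cutoff_D2_def cutoff_D_def power2_eq_square divide_inverse algebra_simps)
qed

lemma continuous_on_cutoff [continuous_intros]:
  "continuous_on A (\<lambda>z. cutoff R z ^ m)"
  "continuous_on A (\<lambda>z. cutoff_D R m e z)"
  "continuous_on A (\<lambda>z. cutoff_D2 R m e z)"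
  unfolding cutoff_def cutoff_D_def cutoff_D2_def divide_inverse by (intro continuous_intros)+

lemma cutoff_eq_0: "R > 0 \<Longrightarrow> norm z \<ge> R \<Longrightarrow> cutoff R z = 0"
  unfolding cutoff_def by (simp add: field_simps dot_square_norm power_mono)

lemma cutoff_nonneg: "cutoff R z \<ge> 0" and cutoff_le_1: "cutoff R z \<le> 1"
  by (auto simp: cutoff_def)

section \<open>Young's inequality and differentiation along lines\<close>

text \<open>If \<open>b\<close> is at most \<open>l * a powr (p - 1)\<close>, the first term alone
  suffices; otherwise \<open>a\<close> is bounded by a power of \<open>b / l\<close> and the second
  does. Sharp constants do not matter, but the power of \<open>l\<close> does: it tends to zero as
  \<open>l\<close> grows.\<close>

lemma young_weighted:
  fixes a b l p :: real
  assumes "a \<ge> 0" "b \<ge> 0" "l > 0" "p > 1"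
  shows "a * b \<le> l * a powr p + l powr (- 1 / (p - 1)) * b powr (p / (p - 1))"
proof (cases "b \<le> l * a powr (p - 1)")
  case True
  have "a * b \<le> a * (l * a powr (p - 1))"
    using True assms by (intro mult_left_mono)
  also have "\<dots> = l * a powr p"
    using assms by (simp add: powr_mult_base)
  finally show ?thesis by (simp add: add_increasing2)
next
  case False
  then have "a powr (p - 1) \<le> b / l" "b > 0"
    using assms by (auto simp: field_simps less_le)
  then have "(a powr (p - 1)) powr (1 / (p - 1)) \<le> (b / l) powr (1 / (p - 1))"
    using assms by (intro powr_mono2) auto
  then have "a \<le> (b / l) powr (1 / (p - 1))"
    using assms by (simp add: powr_powr)
  then have "a * b \<le> (b / l) powr (1 / (p - 1)) * b"
    using assms by (intro mult_right_mono)
  also have "\<dots> = l powr (- 1 / (p - 1)) * b powr (1 / (p - 1) + 1)"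
    unfolding powr_add using assms \<open>b > 0\<close> by (simp add: powr_divide powr_minus field_simps)
  also have "1 / (p - 1) + 1 = p / (p - 1)"
    using assms by (simp add: field_simps)
  finally show ?thesis using assms by (simp add: add_increasing)
qed

text \<open>The parameter set \<open>A\<close> need only be mapped into \<open>S\<close>. This
  covers full lines in space directions and half-lines in time, with one-sided derivatives at
  \<open>t = 0\<close>.\<close>

lemma has_vector_derivative_along_line:
  fixes f :: "'a::real_normed_vector \<Rightarrow> 'b::real_normed_vector"
  assumes "(f has_derivative L) (at (z + s *\<^sub>R e) within S)"
    and "\<And>r. r \<in> A \<Longrightarrow> z + r *\<^sub>R e \<in> S"
  shows "((\<lambda>r. f (z + r *\<^sub>R e)) has_vector_derivative L e) (at s within A)"
proof -
  interpret L: bounded_linear L by (rule has_derivative_bounded_linear[OF assms(1)])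
  have "((\<lambda>r. z + r *\<^sub>R e) has_derivative (\<lambda>h. h *\<^sub>R e)) (at s within A)"
    by (auto intro!: derivative_eq_intros)
  moreover have "(f has_derivative L) (at (z + s *\<^sub>R e) within (\<lambda>r. z + r *\<^sub>R e) ` A)"
    using assms by (intro has_derivative_subset[OF assms(1)]) auto
  ultimately have "((\<lambda>r. f (z + r *\<^sub>R e)) has_derivative (\<lambda>h. L (h *\<^sub>R e))) (at s within A)"
    by (rule has_derivative_in_compose)
  then show ?thesis
    by (simp add: has_vector_derivative_def L.scaleR)
qed

text \<open>The adjoint of the linear operator, applied to a product of \<open>(1 + t) powr \<beta>\<close> and the power
  of the cutoff, equals \<open>(1 + t) powr \<beta>\<close> times this expression with \<open>b = 2 * \<beta> - \<mu>\<close>: the zero order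
  term vanishes when the mass is \<open>(\<beta> - 1) * (\<mu> - \<beta>)\<close>.\<close>

definition cutoff_wave :: "real \<Rightarrow> real \<Rightarrow> nat \<Rightarrow> real \<times> (real ^ 'n) \<Rightarrow> real" where
  "cutoff_wave b R m z = cutoff_D2 R m e_t z + b / (1 + fst z) * cutoff_D R m e_t z
     - (\<Sum>i\<in>UNIV. cutoff_D2 R m (e_x i) z)"

section \<open>Pointwise bounds of order \<open>1 / R\<^sup>2\<close> for the operator on the
  cutoff\<close>

lemma norm_e_t [simp]: "norm (e_t :: real \<times> (real ^ 'n)) = 1"
  and norm_e_x [simp]: "norm (e_x i :: real \<times> (real ^ 'n)) = 1"
  by (simp_all add: e_t_def e_x_def norm_Pair)

lemma abs_inner_unit_le:
  fixes e z :: "'a::real_inner"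
  assumes "norm e = 1" shows "\<bar>z \<bullet> e\<bar> \<le> norm z"
  using Cauchy_Schwarz_ineq2[of z e] assms by simp

text \<open>Lowering the power to \<open>m - 2\<close> gives all bounds the same cutoff factor. The
  bound \<open>c\<close> is left free so that in the time direction it can be \<open>1 + t\<close>
  instead of \<open>R\<close>.\<close>

lemma abs_cutoff_D_le:
  assumes e: "\<bar>z \<bullet> e\<bar> \<le> c"
  shows "\<bar>cutoff_D R m e z\<bar> \<le> 2 * real m * c / R\<^sup>2 * cutoff R z ^ (m - 2)"
proof -
  have "cutoff R z ^ (m - 1) \<le> cutoff R z ^ (m - 2)"
    using cutoff_nonneg[of R z] cutoff_le_1[of R z] by (intro power_decreasing) auto
  then have "\<bar>z \<bullet> e\<bar> * cutoff R z ^ (m - 1) \<le> c * cutoff R z ^ (m - 2)"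
    using cutoff_nonneg[of R z] e by (intro mult_mono) auto
  then have "2 * real m / R\<^sup>2 * (\<bar>z \<bullet> e\<bar> * cutoff R z ^ (m - 1))
      \<le> 2 * real m / R\<^sup>2 * (c * cutoff R z ^ (m - 2))"
    by (rule mult_left_mono) simp
  then show ?thesis
    using cutoff_nonneg[of R z] by (simp add: cutoff_D_def abs_mult mult_ac)
qed

text \<open>Inside the ball \<open>\<bar>z \<bullet> e\<bar>\<close> is at most \<open>R\<close>,
  which cancels one of the two factors \<open>R\<^sup>2\<close> in the quadratic term. Outside,
  everything vanishes because \<open>m - 2\<close> is positive.\<close>

lemma abs_cutoff_D2_le:
  assumes R: "R > 0" and m: "m > 2" and e: "norm e = 1"
  shows "\<bar>cutoff_D2 R m e z\<bar> \<le> (4 * (real m)\<^sup>2 + 2 * real m) / R\<^sup>2 * cutoff R z ^ (m - 2)"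
proof (cases "norm z \<ge> R")
  case True
  then show ?thesis using cutoff_eq_0[OF R True] m by (simp add: cutoff_D2_def power_0_left)
next
  case False
  let ?C = "cutoff R z"
  have gen: "\<bar>4 * a - b\<bar> \<le> 4 * a' + b'" if "a \<le> a'" "b \<le> b'" "0 \<le> a" "0 \<le> b" for a a' b b' :: real
    using that by linarith
  have "(z \<bullet> e)\<^sup>2 \<le> R\<^sup>2"
    using abs_inner_unit_le[OF e, of z] False by (simp add: abs_le_square_iff[symmetric])
  then have "real m * real (m - 1) * ((z \<bullet> e)\<^sup>2 / (R\<^sup>2)\<^sup>2) \<le> real m * real m * (R\<^sup>2 / (R\<^sup>2)\<^sup>2)"
    by (intro mult_mono divide_right_mono) auto
  then have "real m * real (m - 1) * ((z \<bullet> e)\<^sup>2 / (R\<^sup>2)\<^sup>2) * ?C ^ (m - 2)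
      \<le> real m * real m * (R\<^sup>2 / (R\<^sup>2)\<^sup>2) * ?C ^ (m - 2)"
    using cutoff_nonneg[of R z] by (intro mult_right_mono) auto
  moreover have "?C ^ (m - 1) \<le> ?C ^ (m - 2)"
    using cutoff_nonneg[of R z] cutoff_le_1[of R z] by (intro power_decreasing) auto
  then have "2 * real m / R\<^sup>2 * ?C ^ (m - 1) \<le> 2 * real m / R\<^sup>2 * ?C ^ (m - 2)"
    by (intro mult_left_mono) auto
  moreover have "e \<bullet> e = 1" using e by (simp add: dot_square_norm)
  moreover have "0 \<le> real m * real (m - 1) * ((z \<bullet> e)\<^sup>2 / (R\<^sup>2)\<^sup>2) * ?C ^ (m - 2)"
     "0 \<le> 2 * real m / R\<^sup>2 * ?C ^ (m - 1)"
    using cutoff_nonneg[of R z] by auto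
  moreover have "cutoff_D2 R m e z = 4 * (real m * real (m - 1) * ((z \<bullet> e)\<^sup>2 / (R\<^sup>2)\<^sup>2) * ?C ^ (m - 2))
      - 2 * real m / R\<^sup>2 * ?C ^ (m - 1)"
    using \<open>e \<bullet> e = 1\<close> by (simp add: cutoff_D2_def)
  moreover have "(4 * (real m)\<^sup>2 + 2 * real m) / R\<^sup>2 * ?C ^ (m - 2)
      = 4 * (real m * real m * (R\<^sup>2 / (R\<^sup>2)\<^sup>2) * ?C ^ (m - 2)) + 2 * real m / R\<^sup>2 * ?C ^ (m - 2)"
    using R by (simp add: power2_eq_square field_simps)
  ultimately show ?thesis
    using gen by metis
qed

text \<open>The first-order term costs only \<open>1 / R\<^sup>2\<close> as well: the time
  derivative of the cutoff power carries a factor \<open>t\<close>, at most \<open>1 + t\<close>,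
  which cancels the denominator of the coefficient.\<close>

lemma abs_cutoff_wave_le:
  assumes R: "R > 0" and m: "m > 2" and z: "fst z \<ge> 0"
  shows "\<bar>cutoff_wave b R m (z :: real \<times> (real ^ 'n))\<bar>
    \<le> ((real CARD('n) + 1) * (4 * (real m)\<^sup>2 + 2 * real m) + 2 * real m * \<bar>b\<bar>) / R\<^sup>2 * cutoff R z ^ (m - 2)"
proof -
  let ?C = "cutoff R z ^ (m - 2)" and ?K = "4 * (real m)\<^sup>2 + 2 * real m"
  have cancel: "T > 0 \<Longrightarrow> \<bar>b\<bar> / T * (2 * real m * T / R\<^sup>2 * ?C) = 2 * real m * \<bar>b\<bar> / R\<^sup>2 * ?C" for T :: real
    by (simp add: field_simps)
  have "z \<bullet> e_t = fst z" by (cases z) (simp add: e_t_def)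
  then have "\<bar>cutoff_D R m e_t z\<bar> \<le> 2 * real m * (1 + fst z) / R\<^sup>2 * ?C"
    using z by (intro abs_cutoff_D_le) auto
  then have "\<bar>b\<bar> / (1 + fst z) * \<bar>cutoff_D R m e_t z\<bar>
      \<le> \<bar>b\<bar> / (1 + fst z) * (2 * real m * (1 + fst z) / R\<^sup>2 * ?C)"
    using z by (intro mult_left_mono) auto
  also have "\<dots> = 2 * real m * \<bar>b\<bar> / R\<^sup>2 * ?C"
    using z cancel[of "1 + fst z"] by simp
  finally have 1: "\<bar>b / (1 + fst z) * cutoff_D R m e_t z\<bar> \<le> 2 * real m * \<bar>b\<bar> / R\<^sup>2 * ?C"
    using z by (simp add: abs_mult)
  have 2: "\<bar>cutoff_D2 R m e_t z\<bar> \<le> ?K / R\<^sup>2 * ?C"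
    by (rule abs_cutoff_D2_le[OF R m]) simp
  have "\<bar>\<Sum>i\<in>UNIV. cutoff_D2 R m (e_x i) z\<bar> \<le> (\<Sum>i\<in>(UNIV::'n set). \<bar>cutoff_D2 R m (e_x i) z\<bar>)"
    by (rule sum_abs)
  also have "\<dots> \<le> (\<Sum>i\<in>(UNIV::'n set). ?K / R\<^sup>2 * ?C)"
    by (intro sum_mono abs_cutoff_D2_le[OF R m]) simp
  finally have 3: "\<bar>\<Sum>i\<in>UNIV. cutoff_D2 R m (e_x i) z\<bar> \<le> real CARD('n) * (?K / R\<^sup>2 * ?C)"
    by simp
  have "((real CARD('n) + 1) * ?K + 2 * real m * \<bar>b\<bar>) / R\<^sup>2 * ?C
      = real CARD('n) * (?K / R\<^sup>2 * ?C) + ?K / R\<^sup>2 * ?C + 2 * real m * \<bar>b\<bar> / R\<^sup>2 * ?C"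
    by (simp add: add_divide_distrib algebra_simps)
  then show ?thesis using 1 2 3 unfolding cutoff_wave_def by linarith
qed

section \<open>The equation tested against the weighted cutoff\<close>

text \<open>This is the Lagrange identity in time for the weight
  \<open>(1 + t) powr \<beta>\<close>. With \<open>c = \<mu> - \<beta>\<close> the factor of
  \<open>p t\<close> becomes the time part of the damped operator, with mass
  \<open>(\<beta> - 1) * (\<mu> - \<beta>)\<close>, and the remaining terms contain only derivatives
  of \<open>p\<close>.\<close>

lemma time_flux_deriv:
  fixes a p :: "real \<Rightarrow> real"
  assumes t: "t \<ge> 0"
    and a: "(a has_real_derivative a1 t) (at t within A)" "(a1 has_real_derivative a2) (at t within A)"
    and p: "(p has_real_derivative p1 t) (at t within A)" "(p1 has_real_derivative p2) (at t within A)"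
  shows "((\<lambda>t. (1 + t) powr \<beta> * (a1 t * p t - a t * p1 t + c / (1 + t) * a t * p t)) has_real_derivative
     (1 + t) powr \<beta> * (p t * (a2 + (c + \<beta>) / (1 + t) * a1 t + (\<beta> - 1) * c / (1 + t)\<^sup>2 * a t)
       - a t * p2 - (\<beta> - c) / (1 + t) * a t * p1 t)) (at t within A)"
proof -
  have w: "((\<lambda>t. (1 + t) powr \<beta>) has_real_derivative \<beta> * inverse (1 + t) * (1 + t) powr \<beta>) (at t within A)"
    using t by (auto intro!: derivative_eq_intros simp: powr_diff field_simps)
  have v: "((\<lambda>t. c / (1 + t)) has_real_derivative - (c * (inverse (1 + t))\<^sup>2)) (at t within A)"
    using t by (auto intro!: derivative_eq_intros simp: power2_eq_square field_simps)
  show ?thesis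
    by (rule DERIV_cong[OF DERIV_mult[OF w DERIV_add[OF DERIV_diff[OF DERIV_mult[OF a(2) p(1)]
          DERIV_mult[OF a(1) p(2)]] DERIV_mult[OF DERIV_mult[OF v a(1)] p(1)]]]])
      (simp only: divide_inverse power_inverse[symmetric], simp add: algebra_simps power2_eq_square)
qed

text \<open>Two integrations by parts move all derivatives to the cutoff. The space directions
  contribute no boundary term, and the time direction contributes the initial data.\<close>

lemma wave_identity:
  fixes u :: "real \<times> (real ^ 'n) \<Rightarrow> real"
    and Du :: "real \<times> (real ^ 'n) \<Rightarrow> (real \<times> (real ^ 'n)) \<Rightarrow>\<^sub>L real"
    and D2u :: "real \<times> (real ^ 'n) \<Rightarrow> (real \<times> (real ^ 'n)) \<Rightarrow>\<^sub>L ((real \<times> (real ^ 'n)) \<Rightarrow>\<^sub>L real)"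
    and \<beta> \<mu> R :: real and k :: nat
  defines "S \<equiv> {0..} \<times> (UNIV :: (real ^ 'n) set)"
    and "m \<equiv> Suc (Suc (Suc k))"
  assumes Du: "\<And>z. z \<in> S \<Longrightarrow> (u has_derivative blinfun_apply (Du z)) (at z within S)"
    and D2u: "\<And>z. z \<in> S \<Longrightarrow> (Du has_derivative blinfun_apply (D2u z)) (at z within S)"
    and cont: "continuous_on S D2u"
    and R: "R > 0"
  shows "(\<integral>z. indicator S z * ((1 + fst z) powr \<beta> * cutoff R z ^ m *
            (D2u z e_t e_t - (\<Sum>i\<in>UNIV. D2u z (e_x i) (e_x i))
              + \<mu> / (1 + fst z) * Du z e_t + (\<beta> - 1) * (\<mu> - \<beta>) / (1 + fst z)\<^sup>2 * u z)) \<partial>lborel)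
    = (\<integral>z. indicator S z * ((1 + fst z) powr \<beta> * u z * cutoff_wave (2 * \<beta> - \<mu>) R m z) \<partial>lborel)
      - (\<integral>x. (Du (0, x) e_t + (\<mu> - \<beta>) * u (0, x)) * cutoff R (0 :: real, x) ^ m \<partial>lborel)"
proof -
  define W where "W = (\<lambda>z :: real \<times> (real ^ 'n). (1 + fst z) powr \<beta>)"
  define \<phi> where "\<phi> = (\<lambda>z :: real \<times> (real ^ 'n). cutoff R z ^ m)"
  define \<phi>1 where "\<phi>1 = (\<lambda>e (z :: real \<times> (real ^ 'n)). cutoff_D R m e z)"
  define \<phi>2 where "\<phi>2 = (\<lambda>e (z :: real \<times> (real ^ 'n)). cutoff_D2 R m e z)"
  have closed: "closed S" unfolding S_def by (intro closed_Times) auto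
  have pos: "1 + fst z > 0" if "z \<in> S" for z using that by (auto simp: S_def)
  have cu: "continuous_on S u"
    using Du by (intro has_derivative_continuous_on)
  have cDu: "continuous_on S Du"
    using D2u by (intro has_derivative_continuous_on)
  have cW: "continuous_on S W"
    unfolding W_def by (intro continuous_intros) (use pos in force)
  have cdiv: "continuous_on S (\<lambda>z. c / (1 + fst z))" "continuous_on S (\<lambda>z. c / (1 + fst z)\<^sup>2)" for c :: real
    by (intro continuous_intros; use pos in force)+
  have c\<phi>: "continuous_on S \<phi>" "continuous_on S (\<phi>1 e)" "continuous_on S (\<phi>2 e)" for e
    unfolding \<phi>_def \<phi>1_def \<phi>2_def by (intro continuous_intros)+
  note conts = cont cu cDu cW cdiv c\<phi>
  have supp: "\<phi> z = 0" "\<phi>1 e z = 0" "\<phi>2 e z = 0" if "norm z \<ge> R" for z e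
    using cutoff_eq_0[OF R that] by (simp_all add: \<phi>_def \<phi>1_def \<phi>2_def m_def cutoff_D_def cutoff_D2_def)
  have du: "((\<lambda>r. u (z + r *\<^sub>R e)) has_real_derivative Du (z + s *\<^sub>R e) e) (at s within A)"
    if "\<And>r. r \<in> A \<Longrightarrow> z + r *\<^sub>R e \<in> S" "s \<in> A" for z e s A
    using has_vector_derivative_along_line[OF Du] that
    by (simp add: has_real_derivative_iff_has_vector_derivative)
  have d2u: "((\<lambda>r. Du (z + r *\<^sub>R e) e) has_real_derivative D2u (z + s *\<^sub>R e) e e) (at s within A)"
    if "\<And>r. r \<in> A \<Longrightarrow> z + r *\<^sub>R e \<in> S" "s \<in> A" for z e s A
    using bounded_linear.has_vector_derivative[OF blinfun.bounded_linear_left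
        has_vector_derivative_along_line[OF D2u], of z s e A e] that
    by (simp add: has_real_derivative_iff_has_vector_derivative)
  have d\<phi>: "((\<lambda>r. \<phi> (z + r *\<^sub>R e)) has_real_derivative \<phi>1 e (z + s *\<^sub>R e)) (at s within A)"
       "((\<lambda>r. \<phi>1 e (z + r *\<^sub>R e)) has_real_derivative \<phi>2 e (z + s *\<^sub>R e)) (at s within A)" for z e s A
    unfolding \<phi>_def \<phi>1_def \<phi>2_def m_def by (rule cutoff_line_deriv cutoff_D_line_deriv)+
  \<comment> \<open>\<open>G i\<close> is the Green flux in direction \<open>e_x i\<close> and
    \<open>G' i\<close> its derivative; \<open>F\<close> and \<open>F'\<close> are their
    counterparts in time. The unsimplified coefficients in \<open>F'\<close> match
    \<open>time_flux_deriv\<close> with \<open>c = \<mu> - \<beta>\<close>.\<close>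
  define G where "G = (\<lambda>i z. W z * (Du z (e_x i) * \<phi> z - u z * \<phi>1 (e_x i) z))"
  define G' where "G' = (\<lambda>i z. W z * (D2u z (e_x i) (e_x i) * \<phi> z - u z * \<phi>2 (e_x i) z))"
  define F where "F = (\<lambda>z. W z * (Du z e_t * \<phi> z - u z * \<phi>1 e_t z + (\<mu> - \<beta>) / (1 + fst z) * u z * \<phi> z))"
  define F' where "F' = (\<lambda>z. W z * (\<phi> z * (D2u z e_t e_t + ((\<mu> - \<beta>) + \<beta>) / (1 + fst z) * Du z e_t
      + (\<beta> - 1) * (\<mu> - \<beta>) / (1 + fst z)\<^sup>2 * u z)
      - u z * \<phi>2 e_t z - (\<beta> - (\<mu> - \<beta>)) / (1 + fst z) * u z * \<phi>1 e_t z))"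
  have cont_GF: "continuous_on S (G i)" "continuous_on S (G' i)" "continuous_on S F'" for i
    unfolding G_def G'_def F'_def by (intro continuous_intros conts)+
  have int: "integrable lborel (\<lambda>z. indicator S z * G i z)"
      "integrable lborel (\<lambda>z. indicator S z * G' i z)"
      "integrable lborel (\<lambda>z. indicator S z * F' z)" for i
    by (intro integrable_continuous_bounded_support[where R=R] closed cont_GF;
        simp add: G_def G'_def F'_def supp)+
  have space: "(\<integral>z. indicator S z * G' i z \<partial>lborel) = 0" for i
  proof (rule integral_directional_derivative_eq_0[OF int(1,2)])
    fix z :: "real \<times> (real ^ 'n)"
    \<comment> \<open>A shift in a space direction keeps the time, so the indicator and the weight
      are constant along the line.\<close>
    have S: "z + s *\<^sub>R e_x i \<in> S \<longleftrightarrow> z \<in> S" and W: "W (z + s *\<^sub>R e_x i) = W z" for s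
      by (cases z; simp add: S_def W_def e_x_def)+
    show "((\<lambda>s. indicator S (z + s *\<^sub>R e_x i) * G i (z + s *\<^sub>R e_x i)) has_real_derivative
         indicator S (z + s *\<^sub>R e_x i) * G' i (z + s *\<^sub>R e_x i)) (at s)" for s
    proof (cases "z \<in> S")
      case True
        have "((\<lambda>s. W z * (Du (z + s *\<^sub>R e_x i) (e_x i) * \<phi> (z + s *\<^sub>R e_x i)
            - u (z + s *\<^sub>R e_x i) * \<phi>1 (e_x i) (z + s *\<^sub>R e_x i))) has_real_derivative
            W z * (D2u (z + s *\<^sub>R e_x i) (e_x i) (e_x i) * \<phi> (z + s *\<^sub>R e_x i)
            - u (z + s *\<^sub>R e_x i) * \<phi>2 (e_x i) (z + s *\<^sub>R e_x i))) (at s)"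
          by (rule DERIV_cong[OF DERIV_cmult[OF DERIV_diff[OF DERIV_mult[OF d2u d\<phi>(1)] DERIV_mult[OF du d\<phi>(2)]]]])
            (simp_all add: S True)
        then show ?thesis
          by (simp add: S W G_def G'_def True)
    qed (simp add: S)
    show "continuous_on UNIV (\<lambda>s. indicator S (z + s *\<^sub>R e_x i) * G' i (z + s *\<^sub>R e_x i))"
    proof (cases "z \<in> S")
      case True
      then show ?thesis
        by (simp add: S) (intro continuous_on_compose2[OF cont_GF(2)] continuous_intros, auto simp: S)
    qed (simp add: S)
  qed
  have time: "(\<integral>z. indicator S z * F' z \<partial>lborel) = - (\<integral>x. F (0, x) \<partial>lborel)"
    unfolding S_def
  proof (rule integral_halfspace_time_derivative[where R=R])
    fix t :: real and x :: "real ^ 'n" assume t: "t \<ge> 0"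
    have eq: "(0, x) + r *\<^sub>R e_t = (r, x)" for r by (simp add: e_t_def)
    have S: "(r, x) \<in> S \<longleftrightarrow> r \<ge> 0" for r by (simp add: S_def)
    have "((\<lambda>r. u (r, x)) has_real_derivative Du (t, x) e_t) (at t within {0..})"
      using du[of "{0..}" "(0, x)" e_t t] t by (simp add: eq S)
    moreover have "((\<lambda>r. Du (r, x) e_t) has_real_derivative D2u (t, x) e_t e_t) (at t within {0..})"
      using d2u[of "{0..}" "(0, x)" e_t t] t by (simp add: eq S)
    moreover have "((\<lambda>r. \<phi> (r, x)) has_real_derivative \<phi>1 e_t (t, x)) (at t within {0..})"
        "((\<lambda>r. \<phi>1 e_t (r, x)) has_real_derivative \<phi>2 e_t (t, x)) (at t within {0..})"
      using d\<phi>(1)[of "(0, x)" e_t t "{0..}"] d\<phi>(2)[of e_t "(0, x)" t "{0..}"] by (simp_all add: eq)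
    ultimately show "((\<lambda>t. F (t, x)) has_real_derivative F' (t, x)) (at t within {0..})"
      unfolding F_def F'_def W_def fst_conv by (intro time_flux_deriv t)
  qed (use R cont_GF in \<open>auto simp: F_def F'_def supp S_def[symmetric]\<close>)
  \<comment> \<open>At \<open>t = 0\<close> the weight is 1, and \<open>\<phi>1 e_t\<close> vanishes
    because \<open>(0, x)\<close> is orthogonal to \<open>e_t\<close>.\<close>
  have initial: "(\<integral>x. F (0, x) \<partial>lborel)
     = (\<integral>x. (Du (0, x) e_t + (\<mu> - \<beta>) * u (0, x)) * cutoff R (0 :: real, x) ^ m \<partial>lborel)"
    by (intro Bochner_Integration.integral_cong)
      (auto simp: F_def W_def \<phi>_def \<phi>1_def cutoff_D_def e_t_def algebra_simps)
  define H where "H = (\<lambda>i z. indicator S z * G' i z)"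
  define P where "P = (\<lambda>z. indicator S z * F' z)"
  define Q where "Q = (\<lambda>z. indicator S z * (W z * u z * cutoff_wave (2 * \<beta> - \<mu>) R m z))"
  have "indicator S z * (W z * \<phi> z *
            (D2u z e_t e_t - (\<Sum>i\<in>UNIV. D2u z (e_x i) (e_x i))
              + \<mu> / (1 + fst z) * Du z e_t + (\<beta> - 1) * (\<mu> - \<beta>) / (1 + fst z)\<^sup>2 * u z))
    = Q z + (P z - (\<Sum>i\<in>UNIV. H i z))" for z
    unfolding P_def Q_def H_def F'_def G'_def cutoff_wave_def \<phi>1_def[symmetric] \<phi>2_def[symmetric]
    by (simp add: algebra_simps sum_subtractf sum_distrib_left)
  moreover have "integrable lborel Q"
    unfolding Q_def cutoff_wave_def \<phi>1_def[symmetric] \<phi>2_def[symmetric]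
    by (intro integrable_continuous_bounded_support[where R=R] closed continuous_intros conts)
      (simp add: supp)
  moreover have "integrable lborel P" "integrable lborel (H i)" "integral\<^sup>L lborel (H i) = 0" for i
    using int space by (simp_all add: P_def H_def)
  moreover have "integral\<^sup>L lborel P
      = - (\<integral>x. (Du (0, x) e_t + (\<mu> - \<beta>) * u (0, x)) * cutoff R (0 :: real, x) ^ m \<partial>lborel)"
    using time initial by (simp add: P_def)
  ultimately show ?thesis
    unfolding W_def[symmetric] \<phi>_def[symmetric] Q_def[symmetric]
    by (simp add: W_def[symmetric, THEN fun_cong] \<phi>_def[symmetric, THEN fun_cong] Q_def[symmetric, THEN fun_cong])
qed

section \<open>Large radii and the contradiction\<close>

lemma cutoff_mono: "0 < R \<Longrightarrow> R \<le> R' \<Longrightarrow> cutoff R z \<le> cutoff R' z"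
  unfolding cutoff_def by (intro max.mono diff_mono divide_left_mono power_mono order_refl) auto

lemma cutoff_tendsto_1: "(\<lambda>N. cutoff (real (Suc N)) z) \<longlonglongrightarrow> 1"
proof -
  have "(\<lambda>N. inverse (real (Suc N))) \<longlonglongrightarrow> 0"
    by (rule LIMSEQ_inverse_real_of_nat)
  then have "(\<lambda>N. max 0 (1 - (z \<bullet> z) * (inverse (real (Suc N)))\<^sup>2)) \<longlonglongrightarrow> max 0 (1 - (z \<bullet> z) * 0\<^sup>2)"
    by (intro tendsto_intros)
  then show ?thesis by (simp add: cutoff_def divide_inverse power_inverse)
qed

text \<open>The powers of \<open>R\<close> combine to the exponent
  \<open>DIM('a) + \<beta> - 2 * q\<close>, which is nonpositive, so the bound is uniform in
  \<open>R\<close>. The factor \<open>2 powr \<beta>\<close> comes from \<open>1 + R\<close> being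
  at most \<open>2 * R\<close>.\<close>

lemma cutoff_error_le:
  fixes K R q \<beta> :: real
  assumes "R \<ge> 1" "K \<ge> 0" "\<beta> \<ge> 0" "real DIM('a) + \<beta> \<le> 2 * q"
  shows "(K / R\<^sup>2) powr q * (1 + R) powr \<beta> * measure lborel (cball (0 :: 'a::euclidean_space) R)
    \<le> K powr q * 2 powr \<beta> * unit_ball_vol (real DIM('a))"
proof -
  let ?n = "real DIM('a)"
  have R: "R > 0" using assms by simp
  have "R\<^sup>2 powr q = R powr (2 * q)"
    using R by (simp add: powr_powr flip: powr_numeral)
  then have "(K / R\<^sup>2) powr q = K powr q * R powr (- 2 * q)"
    using assms R by (simp add: powr_divide powr_minus_divide)
  moreover have "(1 + R) powr \<beta> \<le> (2 * R) powr \<beta>"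
    using assms by (intro powr_mono2) auto
  then have "(1 + R) powr \<beta> \<le> 2 powr \<beta> * R powr \<beta>"
    using R by (simp add: powr_mult)
  moreover have "measure lborel (cball (0 :: 'a) R) = unit_ball_vol ?n * R powr ?n"
    using R by (simp add: content_cball powr_realpow)
  ultimately have "(K / R\<^sup>2) powr q * (1 + R) powr \<beta> * measure lborel (cball (0 :: 'a) R)
    \<le> K powr q * R powr (- 2 * q) * (2 powr \<beta> * R powr \<beta>) * (unit_ball_vol ?n * R powr ?n)"
    by (auto intro!: mult_mono)
  also have "\<dots> = K powr q * 2 powr \<beta> * unit_ball_vol ?n * R powr (?n + \<beta> - 2 * q)"
    using R by (simp add: powr_add powr_diff powr_minus field_simps)
  also have "\<dots> \<le> K powr q * 2 powr \<beta> * unit_ball_vol ?n * R powr 0"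
    using assms by (intro mult_left_mono powr_mono) auto
  finally show ?thesis using R by simp
qed

text \<open>The error is only bounded when the dimension condition is an equality, so letting the
  radius grow is not enough there. Integrability of the nonlinear term makes the absorbed part
  vanish in the limit for every \<open>l\<close>, after which a large \<open>l\<close> makes the
  error small.\<close>

lemma test_function_contradiction:
  fixes u :: "'a::euclidean_space \<Rightarrow> real" and w :: "'a \<Rightarrow> real" and c :: "nat \<Rightarrow> real"
    and \<beta> p K c0 :: real and m :: nat
  assumes closed: "closed S"
    and cw: "continuous_on S w" and cu: "continuous_on S u"
    and w0: "\<And>z. z \<in> S \<Longrightarrow> 0 \<le> w z" and w1: "\<And>z. z \<in> S \<Longrightarrow> w z \<le> (1 + norm z) powr \<beta>"
    and p: "p > 1" and \<beta>: "\<beta> \<ge> 0" and K: "K \<ge> 0"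
    and dim: "real DIM('a) + \<beta> \<le> 2 * (p / (p - 1))"
    and m: "real m \<le> real (m - 2) * p" "m > 2"
    and c: "c \<longlonglongrightarrow> c0" "c0 > 0"
    and ineq: "\<And>N. (\<integral>z. indicator S z * (w z * \<bar>u z\<bar> powr p * cutoff (real (Suc N)) z ^ m) \<partial>lborel) + c N
       \<le> (\<integral>z. indicator S z * (w z * (\<bar>u z\<bar> * cutoff (real (Suc N)) z ^ (m - 2)) * (K / (real (Suc N))\<^sup>2)) \<partial>lborel)"
  shows False
proof -
  let ?R = "\<lambda>N. real (Suc N)"
  let ?C = "\<lambda>N z. cutoff (real (Suc N)) z"
  define q where "q = p / (p - 1)"
  define a where "a = (\<lambda>z. indicator S z * (w z * \<bar>u z\<bar> powr p))"
  \<comment> \<open>\<open>f N\<close> is the tested nonlinear term, increasing to \<open>a\<close>;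
    \<open>g N\<close> majorizes the linear side; \<open>h N\<close> is the second term of Young's
    inequality without its power of \<open>l\<close>, with integral at most
    \<open>V\<close>.\<close>
  define f where "f = (\<lambda>N z. a z * ?C N z ^ m)"
  define g where "g = (\<lambda>N z. indicator S z * (w z * (\<bar>u z\<bar> * ?C N z ^ (m - 2)) * (K / (?R N)\<^sup>2)))"
  define h where "h = (\<lambda>N (z::'a). (K / (?R N)\<^sup>2) powr q * (1 + ?R N) powr \<beta> * indicator (cball 0 (?R N)) z :: real)"
  define V where "V = K powr q * 2 powr \<beta> * unit_ball_vol (real DIM('a))"
  have V: "V \<ge> 0" unfolding V_def by simp
  have q: "q > 0" using p by (simp add: q_def)
  have C0: "0 \<le> ?C N z" "?C N z \<le> 1" for N z by (simp_all add: cutoff_nonneg cutoff_le_1)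
  have a0: "0 \<le> a z" for z using w0 by (auto simp: a_def indicator_def)
  have f0: "0 \<le> f N z" for N z unfolding f_def using a0 C0 by (intro mult_nonneg_nonneg zero_le_power)
  have cup: "continuous_on S (\<lambda>z. w z * \<bar>u z\<bar> powr p)"
    using p by (intro continuous_intros cw continuous_on_powr' cu) auto
  have [measurable]: "a \<in> borel_measurable borel"
    using borel_measurable_continuous_on_indicator[OF _ cup] closed by (simp add: a_def)
  have int_f: "integrable lborel (f N)" for N
  proof -
    have "integrable lborel (\<lambda>z. indicator S z * (w z * \<bar>u z\<bar> powr p * ?C N z ^ m))"
      using m(2) by (intro integrable_continuous_bounded_support[where R="?R N"] closed continuous_intros cup)
        (auto simp: cutoff_eq_0)
    then show ?thesis by (simp add: f_def a_def mult_ac)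
  qed
  have int_g: "integrable lborel (g N)" for N
    unfolding g_def using m(2)
    by (intro integrable_continuous_bounded_support[where R="?R N"] closed continuous_intros cw cu)
        (auto simp: cutoff_eq_0)
  have int_h: "integrable lborel (h N)" for N
    unfolding h_def by (intro integrable_mult_right integrable_real_indicator)
      (use emeasure_lborel_cball_finite[of "0 :: 'a" "?R N"] in simp_all)
  have h_le: "integral\<^sup>L lborel (h N) \<le> V" for N
    using cutoff_error_le[of "?R N" K \<beta> q, where 'a='a] K \<beta> dim by (simp add: h_def V_def q_def)
  have ineq': "integral\<^sup>L lborel (f N) + c N \<le> integral\<^sup>L lborel (g N)" for N
    using ineq[of N] by (simp add: f_def g_def a_def mult_ac)
  \<comment> \<open>Young's inequality is applied to
    \<open>\<bar>u z\<bar> * ?C N z ^ (m - 2)\<close> and \<open>K / (?R N)\<^sup>2\<close>. The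
    condition on \<open>m\<close> turns the \<open>p\<close>-th power of the first factor's cutoff
    into at most \<open>?C N z ^ m\<close>.\<close>
  have young: "g N z \<le> l * f N z + l powr (- 1 / (p - 1)) * h N z" if l: "l > 0" for l N z
  proof (cases "z \<in> S \<and> norm z < ?R N")
    case False
    then consider "z \<notin> S" | "norm z \<ge> ?R N" by linarith
    then show ?thesis
    proof cases
      case 1 then show ?thesis by (simp add: g_def f_def a_def h_def)
    next
      case 2
      then have "g N z = 0" using m cutoff_eq_0[of "?R N" z] by (simp add: g_def)
      then show ?thesis using f0[of N z] l by (simp add: h_def)
    qed
  next
    case True
    let ?X = "\<bar>u z\<bar> * ?C N z ^ (m - 2)" and ?Y = "K / (?R N)\<^sup>2"
    have "?X powr p = \<bar>u z\<bar> powr p * (?C N z ^ (m - 2)) powr p"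
      using C0 by (simp add: powr_mult)
    also have "(?C N z ^ (m - 2)) powr p \<le> ?C N z ^ m"
    proof (cases "?C N z = 0")
      case True then show ?thesis using m by (simp add: power_0_left)
    next
      case False
      then have pos: "?C N z > 0" using C0[of N z] by linarith
      have "(?C N z ^ (m - 2)) powr p = ?C N z powr (real (m - 2) * p)"
        using pos by (simp add: powr_powr flip: powr_realpow)
      also have "\<dots> \<le> ?C N z powr real m"
        using C0[of N z] m pos by (intro powr_mono') auto
      finally show ?thesis using pos by (simp add: powr_realpow)
    qed
    finally have X: "?X powr p \<le> \<bar>u z\<bar> powr p * ?C N z ^ m"
      by (simp add: mult_left_mono)
    have "?X * ?Y \<le> l * ?X powr p + l powr (- 1 / (p - 1)) * ?Y powr q"
      unfolding q_def by (intro young_weighted mult_nonneg_nonneg zero_le_power C0(1) l p) (use K in simp_all)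
    also have "\<dots> \<le> l * (\<bar>u z\<bar> powr p * ?C N z ^ m) + l powr (- 1 / (p - 1)) * ?Y powr q"
      using X l by simp
    finally have "w z * (?X * ?Y) \<le> w z * (l * (\<bar>u z\<bar> powr p * ?C N z ^ m) + l powr (- 1 / (p - 1)) * ?Y powr q)"
      using w0 True by (intro mult_left_mono) auto
    also have "\<dots> = l * f N z + l powr (- 1 / (p - 1)) * (?Y powr q * w z)"
      using True by (simp add: f_def a_def algebra_simps)
    also have "\<dots> \<le> l * f N z + l powr (- 1 / (p - 1)) * h N z"
    proof -
      have "w z \<le> (1 + ?R N) powr \<beta>"
        using w1[of z] True \<beta> powr_mono2[of \<beta> "1 + norm z" "1 + ?R N"] by fastforce
      then have "?Y powr q * w z \<le> h N z"
        using True by (simp add: h_def mult_left_mono)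
      then show ?thesis by (simp add: mult_left_mono)
    qed
    finally show ?thesis using True by (simp add: g_def mult_ac)
  qed
  have int_a: "integrable lborel a"
  proof -
    obtain B where B: "\<And>N. \<bar>c N\<bar> \<le> B"
      using convergent_imp_Bseq[OF convergentI[OF c(1)]] unfolding Bseq_def real_norm_def by blast
    define M where "M = (1/2) powr (- 1 / (p - 1)) * V"
    \<comment> \<open>With \<open>l = 1/2\<close> half of the integral of \<open>f N\<close> is
      absorbed on the left. The bound \<open>B\<close> handles \<open>c N\<close>, which may be
      negative for small \<open>N\<close>.\<close>
    have bound: "integral\<^sup>L lborel (f N) \<le> 2 * (M + B)" for N
    proof -
      have "integral\<^sup>L lborel (g N) \<le> (\<integral>z. (1/2) * f N z + (1/2) powr (- 1 / (p - 1)) * h N z \<partial>lborel)"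
        by (intro integral_mono int_g Bochner_Integration.integrable_add integrable_mult_right int_f int_h young) auto
      also have "\<dots> = (1/2) * integral\<^sup>L lborel (f N) + (1/2) powr (- 1 / (p - 1)) * integral\<^sup>L lborel (h N)"
        using int_f[of N] int_h[of N] by simp
      also have "\<dots> \<le> (1/2) * integral\<^sup>L lborel (f N) + M"
        unfolding M_def using h_le[of N] by (intro add_left_mono mult_left_mono) auto
      finally show ?thesis using ineq'[of N] B[of N] by (simp add: abs_le_iff)
    qed
    have mono: "f N z \<le> f N' z" if "N \<le> N'" for N N' z
      unfolding f_def using that a0 C0 by (intro mult_left_mono power_mono cutoff_mono) auto
    have "incseq (\<lambda>N. integral\<^sup>L lborel (f N))"
      by (intro incseq_SucI integral_mono int_f mono) auto
    then obtain L where "(\<lambda>N. integral\<^sup>L lborel (f N)) \<longlonglongrightarrow> L"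
      using incseq_convergent[of _ "2 * (M + B)"] bound by blast
    moreover have "(\<lambda>N. f N z) \<longlonglongrightarrow> a z" for z
      using tendsto_mult[OF tendsto_const tendsto_power[OF cutoff_tendsto_1], of "a z" z m]
      by (simp add: f_def)
    ultimately show ?thesis
      using mono by (intro integrable_monotone_convergence[of lborel f a L] int_f) (auto simp: incseq_def)
  qed
  have g0: "0 \<le> g N z" for N z
  proof (cases "z \<in> S")
    case True
    then have "0 \<le> w z * (\<bar>u z\<bar> * ?C N z ^ (m - 2)) * (K / (?R N)\<^sup>2)"
      using w0 K by (intro mult_nonneg_nonneg divide_nonneg_nonneg zero_le_power C0(1)) auto
    then show ?thesis using True by (simp add: g_def)
  qed (simp add: g_def)
  have g_lim: "(\<lambda>N. g N z) \<longlonglongrightarrow> 0" for z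
  proof -
    have "(\<lambda>N. indicator S z * (w z * (\<bar>u z\<bar> * ?C N z ^ (m - 2)) * (K * (inverse (?R N))\<^sup>2)))
        \<longlonglongrightarrow> indicator S z * (w z * (\<bar>u z\<bar> * 1 ^ (m - 2)) * (K * 0\<^sup>2))"
      by (intro tendsto_intros cutoff_tendsto_1 LIMSEQ_inverse_real_of_nat)
    then show ?thesis by (simp add: g_def divide_inverse power_inverse)
  qed
  have c0_le: "c0 \<le> l powr (- 1 / (p - 1)) * V" if l: "l > 0" for l
  proof -
    let ?M = "l powr (- 1 / (p - 1))"
    \<comment> \<open>The positive part of \<open>g N\<close> minus its error term is dominated by
      \<open>l * a\<close> and tends to zero pointwise with \<open>g N\<close>, so its integral
      vanishes in the limit although that of \<open>h N\<close> need not.\<close>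
    define e where "e = (\<lambda>N z. max 0 (g N z - ?M * h N z))"
    have int_gh: "integrable lborel (\<lambda>z. g N z - ?M * h N z)" for N
      using int_g int_h by auto
    have int_e: "integrable lborel (e N)" for N
      unfolding e_def by (intro integrable_max int_gh) auto
    have h0: "0 \<le> h N z" for N z by (simp add: h_def)
    have lim: "(\<lambda>N. integral\<^sup>L lborel (e N)) \<longlonglongrightarrow> (\<integral>z. 0 \<partial>(lborel :: 'a measure))"
    proof (rule integral_dominated_convergence[where w="\<lambda>z. l * a z"])
      show "integrable lborel (\<lambda>z. l * a z)" using int_a by simp
      show "e N \<in> borel_measurable lborel" for N using int_e by auto
      show "AE z in lborel. (\<lambda>N. e N z) \<longlonglongrightarrow> 0"
      proof (rule AE_I2)
        fix z
        have "e N z \<le> g N z" for N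
          using g0[of N z] h0[of N z] by (simp add: e_def)
        then show "(\<lambda>N. e N z) \<longlonglongrightarrow> 0"
          by (intro tendsto_sandwich[OF _ _ tendsto_const g_lim[of z]] always_eventually allI)
            (auto simp: e_def)
      qed
      show "AE z in lborel. norm (e N z) \<le> l * a z" for N
      proof (rule AE_I2)
        fix z
        have "l * f N z \<le> l * a z"
          using C0[of N z] a0[of z] l by (simp add: f_def mult_left_le power_le_one)
        then have "g N z - ?M * h N z \<le> l * a z" using young[OF l, of N z] by linarith
        moreover have "0 \<le> l * a z" using a0[of z] l by simp
        ultimately show "norm (e N z) \<le> l * a z" by (simp add: e_def)
      qed
    qed simp
    have "c N \<le> integral\<^sup>L lborel (e N) + ?M * V" for N
    proof -
      have "c N \<le> integral\<^sup>L lborel (g N)"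
        using ineq'[of N] Bochner_Integration.integral_nonneg[of lborel "f N", OF f0] by linarith
      also have "\<dots> \<le> (\<integral>z. e N z + ?M * h N z \<partial>lborel)"
        by (intro integral_mono int_g Bochner_Integration.integrable_add integrable_mult_right int_e int_h)
          (auto simp: e_def)
      also have "\<dots> = integral\<^sup>L lborel (e N) + ?M * integral\<^sup>L lborel (h N)"
        using int_e[of N] int_h[of N] by simp
      also have "\<dots> \<le> integral\<^sup>L lborel (e N) + ?M * V"
        using h_le[of N] by (intro add_left_mono mult_left_mono) auto
      finally show ?thesis .
    qed
    moreover have "(\<lambda>N. integral\<^sup>L lborel (e N) + ?M * V) \<longlonglongrightarrow> 0 + ?M * V"
      using lim by (intro tendsto_intros) simp
    ultimately show ?thesis
      using LIMSEQ_le[OF c(1)] by fastforce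
  qed
  \<comment> \<open>This \<open>l\<close> gives
    \<open>l powr (- 1 / (p - 1)) = c0 / (V + 1)\<close>, hence \<open>c0 * (V + 1)\<close> would be
    at most \<open>c0 * V\<close>.\<close>
  have "((V + 1) / c0) powr (p - 1) > 0" using V c by simp
  from c0_le[OF this] have "c0 \<le> (((V + 1) / c0) powr (p - 1)) powr (- 1 / (p - 1)) * V" .
  also have "(((V + 1) / c0) powr (p - 1)) powr (- 1 / (p - 1)) = c0 / (V + 1)"
    using p V c by (simp add: powr_powr powr_minus)
  finally show False using c V by (simp add: field_simps)
qed

section \<open>Application to the damped wave equation\<close>

text \<open>The mass is parametrized by \<beta> so that \<open>(1 + t) powr \<beta>\<close> solves
  the adjoint equation. The dimension condition counts time as one more dimension.\<close>

lemma no_global_solution: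
  fixes u :: "real \<times> (real ^ 'n) \<Rightarrow> real"
  assumes sol: "global_C2_solution \<mu> ((\<beta> - 1) * (\<mu> - \<beta>)) p u0 u1 u"
    and p: "p > 1" and \<beta>: "\<beta> \<ge> 0"
    and dim: "real CARD('n) + 1 + \<beta> \<le> 2 * (p / (p - 1))"
    and supp: "bounded {x. u0 x \<noteq> 0}" "bounded {x. u1 x \<noteq> 0}"
    and pos: "integral UNIV (\<lambda>x. u1 x + (\<mu> - \<beta>) * u0 x) > 0"
  shows False
proof -
  define S where "S = {0 :: real..} \<times> (UNIV :: (real ^ 'n) set)"
  obtain Du D2u where
      Du: "\<And>z. z \<in> S \<Longrightarrow> (u has_derivative blinfun_apply (Du z)) (at z within S)"
    and cDu: "continuous_on S Du"
    and D2u: "\<And>z. z \<in> S \<Longrightarrow> (Du has_derivative blinfun_apply (D2u z)) (at z within S)"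
    and cD2u: "continuous_on S D2u"
    and pde: "\<And>t x. t \<ge> 0 \<Longrightarrow> D2u (t, x) e_t e_t - (\<Sum>i\<in>UNIV. D2u (t, x) (e_x i) (e_x i))
          + \<mu> / (1 + t) * Du (t, x) e_t + (\<beta> - 1) * (\<mu> - \<beta>) / (1 + t)^2 * u (t, x)
          = \<bar>u (t, x)\<bar> powr p"
    and init: "\<And>x. u (0, x) = u0 x" "\<And>x. Du (0, x) e_t = u1 x"
    using sol unfolding global_C2_solution_def Let_def S_def by blast
  have closed: "closed S" unfolding S_def by (intro closed_Times) auto
  have cu: "continuous_on S u"
    using Du by (intro has_derivative_continuous_on)
  have S0: "(0, x) \<in> S" for x by (simp add: S_def)
  have "continuous_on UNIV (\<lambda>x. u (0, x))"
    by (rule continuous_on_compose2[OF cu]) (auto intro!: continuous_intros simp: S0)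
  then have c0: "continuous_on UNIV u0" by (simp add: init)
  have "continuous_on UNIV (\<lambda>x. Du (0, x) e_t)"
    by (intro continuous_intros continuous_on_compose2[OF cDu]) (auto simp: S0)
  then have c1: "continuous_on UNIV u1" by (simp add: init)
  define v where "v = (\<lambda>x. u1 x + (\<mu> - \<beta>) * u0 x)"
  obtain \<rho> where \<rho>: "\<And>x. u0 x \<noteq> 0 \<Longrightarrow> norm x \<le> \<rho>" "\<And>x. u1 x \<noteq> 0 \<Longrightarrow> norm x \<le> \<rho>"
    using bounded_Un[of "{x. u0 x \<noteq> 0}" "{x. u1 x \<noteq> 0}"] supp unfolding bounded_iff by auto
  have cv: "continuous_on UNIV v" unfolding v_def by (intro continuous_intros c0 c1)
  have int_v: "integrable lborel v"
  proof -
    have "v x = 0" if "norm x > \<rho>" for x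
    proof -
      have "u0 x = 0" "u1 x = 0" using \<rho>[of x] that by linarith+
      then show ?thesis by (simp add: v_def)
    qed
    then show ?thesis
      using integrable_continuous_bounded_support[OF closed_UNIV cv, of \<rho>] by simp
  qed
  \<comment> \<open>The condition \<open>real m \<le> real (m - 2) * p\<close> is equivalent to
    \<open>2 * p \<le> real m * (p - 1)\<close>, so any \<open>m\<close> above
    \<open>2 * p / (p - 1)\<close> will do.\<close>
  obtain k :: nat where k: "2 * p / (p - 1) \<le> real k" using real_arch_simple by blast
  define m where "m = Suc (Suc (Suc k))"
  have m2: "m > 2" by (simp add: m_def)
  have "2 * p \<le> real k * (p - 1)" using k p by (simp add: field_simps)
  then have "2 * p \<le> real m * (p - 1)" using p by (simp add: m_def algebra_simps)
  then have m: "real m \<le> real (m - 2) * p"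
    using m2 by (simp add: of_nat_diff algebra_simps)
  define K where "K = (real CARD('n) + 1) * (4 * (real m)\<^sup>2 + 2 * real m) + 2 * real m * \<bar>2 * \<beta> - \<mu>\<bar>"
  let ?R = "\<lambda>N. real (Suc N)"
  define c where "c = (\<lambda>N. \<integral>x. v x * cutoff (?R N) (0 :: real, x) ^ m \<partial>lborel)"
  \<comment> \<open>The cutoffs lie between 0 and 1 and tend to 1, so dominated convergence recovers
    the full data integral.\<close>
  have c_lim: "c \<longlonglongrightarrow> integral\<^sup>L lborel v"
    unfolding c_def
  proof (rule integral_dominated_convergence[where w="\<lambda>x. \<bar>v x\<bar>"])
    show "AE x in lborel. (\<lambda>N. v x * cutoff (?R N) (0 :: real, x) ^ m) \<longlonglongrightarrow> v x"
      using tendsto_mult[OF tendsto_const tendsto_power[OF cutoff_tendsto_1]] by force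
    show "AE x in lborel. norm (v x * cutoff (?R N) (0 :: real, x) ^ m) \<le> \<bar>v x\<bar>" for N
    proof (rule AE_I2)
      fix x :: "real ^ 'n"
      have "\<bar>cutoff (?R N) (0 :: real, x) ^ m\<bar> \<le> 1"
        unfolding power_abs abs_of_nonneg[OF cutoff_nonneg]
        by (intro power_le_one cutoff_nonneg cutoff_le_1)
      then show "norm (v x * cutoff (?R N) (0 :: real, x) ^ m) \<le> \<bar>v x\<bar>"
        unfolding real_norm_def abs_mult by (intro mult_left_le) auto
    qed
    show "(\<lambda>x. v x * cutoff (?R N) (0 :: real, x) ^ m) \<in> borel_measurable lborel" for N
    proof -
      have "continuous_on UNIV (\<lambda>x. v x * cutoff (?R N) (0 :: real, x) ^ m)"
        by (intro continuous_intros cv continuous_on_compose2[OF continuous_on_cutoff(1)[of UNIV]]) auto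
      then show ?thesis by (simp add: borel_measurable_continuous_onI)
    qed
  qed (use int_v in auto)
  let ?w = "\<lambda>z :: real \<times> (real ^ 'n). (1 + fst z) powr \<beta>"
  have cw: "continuous_on S ?w"
    by (intro continuous_intros) (force simp: S_def)
  show False
  proof (rule test_function_contradiction[OF closed cw cu _ _ p \<beta> _ _ m m2 c_lim])
    fix z assume z: "z \<in> S"
    then have "fst z \<ge> 0" by (auto simp: S_def)
    then show "0 \<le> ?w z" "?w z \<le> (1 + norm z) powr \<beta>"
      using norm_fst_le[of "fst z" "snd z"] \<beta> by (auto intro!: powr_mono2)
  next
    show "K \<ge> 0" by (simp add: K_def)
    show "real DIM(real \<times> (real ^ 'n)) + \<beta> \<le> 2 * (p / (p - 1))"
      using dim by simp
    show "0 < integral\<^sup>L lborel v" using pos integral_lborel[OF int_v] by (simp add: v_def)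
    fix N
    let ?C = "\<lambda>z. cutoff (?R N) (z :: real \<times> (real ^ 'n))"
    \<comment> \<open>The equation replaces the nonlinear term by the linear operator, the form
      required by \<open>wave_identity\<close>.\<close>
    have eq: "(\<integral>z. indicator S z * (?w z * \<bar>u z\<bar> powr p * ?C z ^ m) \<partial>lborel)
        = (\<integral>z. indicator S z * (?w z * ?C z ^ m *
            (D2u z e_t e_t - (\<Sum>i\<in>UNIV. D2u z (e_x i) (e_x i))
              + \<mu> / (1 + fst z) * Du z e_t + (\<beta> - 1) * (\<mu> - \<beta>) / (1 + fst z)\<^sup>2 * u z)) \<partial>lborel)"
    proof (rule Bochner_Integration.integral_cong)
      fix z
      show "indicator S z * (?w z * \<bar>u z\<bar> powr p * ?C z ^ m)
         = indicator S z * (?w z * ?C z ^ m *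
            (D2u z e_t e_t - (\<Sum>i\<in>UNIV. D2u z (e_x i) (e_x i))
              + \<mu> / (1 + fst z) * Du z e_t + (\<beta> - 1) * (\<mu> - \<beta>) / (1 + fst z)\<^sup>2 * u z))"
      proof (cases "z \<in> S")
        case True
        then have "fst z \<ge> 0" by (auto simp: S_def)
        from pde[OF this, of "snd z"] show ?thesis by (simp add: mult_ac)
      qed simp
    qed simp
    let ?J = "\<lambda>z. indicator S z * (?w z * u z * cutoff_wave (2 * \<beta> - \<mu>) (?R N) m z)"
    let ?g = "\<lambda>z. indicator S z * (?w z * (\<bar>u z\<bar> * ?C z ^ (m - 2)) * (K / (?R N)\<^sup>2))"
    have cJ: "continuous_on S (\<lambda>z. ?w z * u z * cutoff_wave (2 * \<beta> - \<mu>) (?R N) m z)"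
      unfolding cutoff_wave_def by (intro continuous_intros cw cu) (force simp: S_def)
    have int_g: "integrable lborel ?g"
      using m2 by (intro integrable_continuous_bounded_support[where R="?R N"] closed continuous_intros cw cu)
        (auto simp: cutoff_eq_0)
    have le: "\<bar>?J z\<bar> \<le> ?g z" for z
    proof (cases "z \<in> S")
      case True
      then have "fst z \<ge> 0" by (auto simp: S_def)
      then have "\<bar>cutoff_wave (2 * \<beta> - \<mu>) (?R N) m z\<bar> \<le> K / (?R N)\<^sup>2 * ?C z ^ (m - 2)"
        unfolding K_def by (intro abs_cutoff_wave_le m2) auto
      then have "?w z * \<bar>u z\<bar> * \<bar>cutoff_wave (2 * \<beta> - \<mu>) (?R N) m z\<bar>
          \<le> ?w z * \<bar>u z\<bar> * (K / (?R N)\<^sup>2 * ?C z ^ (m - 2))"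
        by (intro mult_left_mono) auto
      then show ?thesis using True by (simp add: abs_mult mult_ac)
    qed simp
    have "integral\<^sup>L lborel ?J \<le> integral\<^sup>L lborel ?g"
    proof (rule integral_mono)
      have "?J \<in> borel_measurable lborel"
        using borel_measurable_continuous_on_indicator[OF _ cJ] closed by simp
      then show "integrable lborel ?J"
      proof (rule Bochner_Integration.integrable_bound[OF int_g])
        show "AE z in lborel. norm (?J z) \<le> norm (?g z)"
          unfolding real_norm_def by (intro AE_I2 order_trans[OF le abs_ge_self])
      qed
    qed (use int_g le abs_le_D1 in blast)+
    moreover have "c N = (\<integral>x. (Du (0, x) e_t + (\<mu> - \<beta>) * u (0, x)) * ?C (0, x) ^ m \<partial>lborel)"
      by (simp add: c_def v_def init)
    ultimately show "(\<integral>z. indicator S z * (?w z * \<bar>u z\<bar> powr p * ?C z ^ m) \<partial>lborel) + c N \<le> integral\<^sup>L lborel ?g"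
      using wave_identity[of u Du D2u "?R N" \<beta> k \<mu>] Du D2u cD2u
      unfolding eq S_def[symmetric] m_def[symmetric] by simp
  qed
qed

theorem theorem2p3:
  fixes mu1 mu2sq p :: real
    and u0 u1 :: "real ^ 'n \<Rightarrow> real"
  defines "\<delta> \<equiv> (mu1 - 1)^2 - 4 * mu2sq"
  assumes "mu1 \<ge> 0" and "mu2sq \<ge> 0" and "\<delta> \<ge> 0"
    and "bounded {x. u0 x \<noteq> 0}" and "bounded {x. u1 x \<noteq> 0}"
    and "integral UNIV u0 > 0"
    and "integral UNIV (\<lambda>x. u1 x + ((mu1 - 1) / 2 - sqrt \<delta> / 2) * u0 x) > 0"
    and "1 < p"
    and "ereal p \<le> pFuj (real CARD('n) + (mu1 - 1) / 2 - sqrt \<delta> / 2)"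
  shows "\<not> (\<exists>u. global_C2_solution mu1 mu2sq p u0 u1 u)"
proof
  assume "\<exists>u. global_C2_solution mu1 mu2sq p u0 u1 u"
  then obtain u where sol: "global_C2_solution mu1 mu2sq p u0 u1 u" ..
  \<comment> \<open>This is the smaller root of
    \<open>(\<beta> - 1) * (mu1 - \<beta>) = mu2sq\<close>, whose discriminant is \<delta>; the
    slower weight gives the weaker dimension condition.\<close>
  define \<beta> where "\<beta> = (mu1 + 1) / 2 - sqrt \<delta> / 2"
  have sq: "(sqrt \<delta>)\<^sup>2 = \<delta>" using assms by simp
  have "sqrt \<delta> \<le> \<bar>mu1 - 1\<bar>"
    using real_sqrt_le_mono[of \<delta> "(mu1 - 1)\<^sup>2"] assms by (simp add: \<delta>_def)
  \<comment> \<open>The bound on \<open>sqrt \<delta>\<close> makes \<beta> at least the minimum of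
    \<open>mu1\<close> and 1.\<close>
  then have \<beta>: "\<beta> \<ge> 0" using assms(2) by (simp add: \<beta>_def abs_if split: if_splits)
  have mu2sq: "mu2sq = (\<beta> - 1) * (mu1 - \<beta>)"
    using sq unfolding \<beta>_def \<delta>_def by (simp add: field_simps power2_eq_square)
  let ?k = "real CARD('n) + \<beta> - 1"
  have "CARD('n) \<ge> 1" using zero_less_card_finite[where 'a='n] by linarith
  then have k: "?k \<ge> 0" using \<beta> by linarith
  \<comment> \<open>\<open>?k\<close> is the argument of \<open>pFuj\<close>. When it is zero
    \<open>pFuj\<close> is infinite, and the product form holds trivially.\<close>
  have "?k * (p - 1) \<le> 2"
  proof (cases "?k = 0")
    case False
    have "?k = real CARD('n) + (mu1 - 1) / 2 - sqrt \<delta> / 2" by (simp add: \<beta>_def field_simps)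
    then have "ereal p \<le> pFuj ?k" using assms(10) by (simp only:)
    then have "p \<le> 1 + 2 / ?k" using False by (simp add: pFuj_def)
    then show ?thesis using False k by (simp add: field_simps)
  qed simp
  then have "real CARD('n) + 1 + \<beta> \<le> 2 * (p / (p - 1))"
    using \<open>1 < p\<close> by (simp add: field_simps)
  \<comment> \<open>Here \<open>mu1 - \<beta>\<close> is
    \<open>(mu1 - 1) / 2 + sqrt \<delta> / 2\<close>, so the initial term exceeds the assumed one by
    \<open>sqrt \<delta>\<close> times the integral of \<open>u0\<close>; this is where positivity
    of both integrals enters.\<close>
  moreover have "integral UNIV (\<lambda>x. u1 x + (mu1 - \<beta>) * u0 x) > 0"
  proof -
    let ?v = "\<lambda>x. u1 x + ((mu1 - 1) / 2 - sqrt \<delta> / 2) * u0 x"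
    \<comment> \<open>The integral of a non-integrable function is 0 by convention, so positivity
      already implies integrability.\<close>
    have "u0 integrable_on UNIV" "?v integrable_on UNIV"
      using assms(7,8) not_integrable_integral by fastforce+
    then have "integral UNIV (\<lambda>x. ?v x + sqrt \<delta> * u0 x) = integral UNIV ?v + sqrt \<delta> * integral UNIV u0"
      using Henstock_Kurzweil_Integration.integral_add[of ?v UNIV "\<lambda>x. sqrt \<delta> * u0 x"]
      by (simp add: integrable_on_mult_right)
    moreover have "?v x + sqrt \<delta> * u0 x = u1 x + (mu1 - \<beta>) * u0 x" for x
      by (simp add: \<beta>_def field_simps)
    ultimately have "integral UNIV (\<lambda>x. u1 x + (mu1 - \<beta>) * u0 x) = integral UNIV ?v + sqrt \<delta> * integral UNIV u0"
      by (simp only:)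
    moreover have "sqrt \<delta> * integral UNIV u0 \<ge> 0"
      using assms(4,7) by simp
    ultimately show ?thesis
      using assms(8) by linarith
  qed
  ultimately show False
    using no_global_solution[of mu1 \<beta> p u0 u1 u] sol \<beta> assms unfolding mu2sq by blast
qed

end
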